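(* Let $G=(V,E,m_1,m_2)$ be a finite connected undirected graph with $E=\{e_1,\dots,e_n\}$, $n\ge1$, vertex measure $m_1:V\to(0,\infty)$ and symmetric edge measure $m_2:E\to(0,\infty)$. For every initial value $\boldsymbol\omega_0\in\mathbb R^n$ with all entries positive, the weighted Forman Ricci flow $$\frac{d}{dt}\boldsymbol\omega(t)=\mathbf F\,\boldsymbol\omega(t),\quad t>0,\qquad \boldsymbol\omega(0)=\boldsymbol\omega_0,$$ has a unique positive solution for all $t\in(0,\infty)$, namely $\boldsymbol\omega(t)=e^{t\mathbf F}\boldsymbol\omega_0$ (positive meaning that all entries of $\boldsymbol\omega(t)$ are positive).
   Context: Graphs are simple (no loops or multiple edges). Write $e_i=(u_i,v_i)$; two distinct edges share at most one vertex. The matrix $\mathbf F\in\mathbb R^{n\times n}$ is given by $$\mathbf F_{ii}=-\Big(\frac{m_2(e_i)}{m_1(u_i)}+\frac{m_2(e_i)}{m_1(v_i)}\Big),$$ and for $i\ne j$, $\mathbf F_{ij}=\frac{m_2(e_j)}{m_1(x)}$ if $e_i$ and $e_j$ share the vertex $x$, and $\mathbf F_{ij}=0$ if they share no vertex. With $\boldsymbol\omega(t)=(\omega(t,e_1),\dots,\omega(t,e_n))^T$, this linear system is the flow $\frac{d}{dt}\omega(t,e)=-F_\omega(t,e)\omega(t,e)$, where the weighted Forman curvature of $e=(u,v)$ is $$F_\omega(e)=\frac{m_2(e)}{m_1(u)}+\frac{m_2(e)}{m_1(v)}-\sum_{e'\ni u,\,e'\ne e}\frac{m_2(e')}{m_1(u)}\frac{\omega(e')}{\omega(e)}-\sum_{e'\ni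 v,\,e'\ne e}\frac{m_2(e')}{m_1(v)}\frac{\omega(e')}{\omega(e)}$$ (sums over edges $e'\in E$; empty sums are $0$). *)

theory Defs
  imports "HOL-Analysis.Analysis"
begin

definition simple_graph :: "'v set \<Rightarrow> 'v set set \<Rightarrow> bool" where
  "simple_graph V E \<longleftrightarrow> finite V \<and> (\<forall>e\<in>E. e \<subseteq> V \<and> card e = 2)"

definition graph_connected :: "'v set \<Rightarrow> 'v set set \<Rightarrow> bool" where
  "graph_connected V E \<longleftrightarrow> (\<forall>x\<in>V. \<forall>y\<in>V. (x, y) \<in> {(a, b). {a, b} \<in> E}\<^sup>*)"

text \<open>
  An enumeration of the edges by a finite index type \<open>'n\<close> (so \<open>CARD('n) \<ge> 1\<close> is the number of
  edges), together with an arbitrary choice of the order of the two endpoints of each edge.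
\<close>

definition edge_enumeration :: "'v set set \<Rightarrow> ('n::finite \<Rightarrow> 'v) \<Rightarrow> ('n \<Rightarrow> 'v) \<Rightarrow> bool" where
  "edge_enumeration E u v \<longleftrightarrow> bij_betw (\<lambda>i. {u i, v i}) UNIV E"

text \<open>
  In the off-diagonal entries the described vertex is unique, since distinct edges of a simple
  graph share at most one vertex. The edge measure takes unordered edges, hence is symmetric.
\<close>

definition forman_matrix ::
  "('v \<Rightarrow> real) \<Rightarrow> ('v set \<Rightarrow> real) \<Rightarrow> ('n::finite \<Rightarrow> 'v) \<Rightarrow> ('n \<Rightarrow> 'v) \<Rightarrow> real^'n^'n" where
  "forman_matrix m1 m2 u v = (\<chi> i j.
     if i = j then - (m2 {u i, v i} / m1 (u i) + m2 {u i, v i} / m1 (v i))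
     else if {u i, v i} \<inter> {u j, v j} \<noteq> {}
       then m2 {u j, v j} / m1 (THE x. x \<in> {u i, v i} \<inter> {u j, v j})
     else 0)"

definition forman_curvature ::
  "'v set set \<Rightarrow> ('v \<Rightarrow> real) \<Rightarrow> ('v set \<Rightarrow> real) \<Rightarrow> ('v set \<Rightarrow> real) \<Rightarrow> 'v \<Rightarrow> 'v \<Rightarrow> real" where
  "forman_curvature E m1 m2 w a b =
     m2 {a, b} / m1 a + m2 {a, b} / m1 b
     - (\<Sum>e' | e' \<in> E \<and> a \<in> e' \<and> e' \<noteq> {a, b}. m2 e' / m1 a * (w e' / w {a, b}))
     - (\<Sum>e' | e' \<in> E \<and> b \<in> e' \<and> e' \<noteq> {a, b}. m2 e' / m1 b * (w e' / w {a, b}))"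

text \<open>
  The square-matrix type carries no Banach algebra structure with \<open>**\<close> as multiplication, so
  \<^const>\<open>exp\<close> is not available for it; the exponential is its power series.
\<close>

definition matrix_exp :: "real^'n^'n \<Rightarrow> real^'n^'n" where
  "matrix_exp A = (\<Sum>k. (1 / fact k) *\<^sub>R ((\<lambda>B. A ** B) ^^ k) (mat 1))"

text \<open>
  The equation is required for \<open>t > 0\<close> only; continuity on \<open>{0..}\<close> links the initial value to the
  solution. Values at negative times are irrelevant.
\<close>

definition linear_flow_solution ::
  "real^'n^'n \<Rightarrow> real^'n \<Rightarrow> (real \<Rightarrow> real^'n) \<Rightarrow> bool" where
  "linear_flow_solution A w0 w \<longleftrightarrow>
     continuous_on {0..} w \<and> w 0 = w0 \<and>
     (\<forall>t>0. (w has_vector_derivative A *v w t) (at t))"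

definition positive_flow :: "(real \<Rightarrow> real^'n) \<Rightarrow> bool" where
  "positive_flow w \<longleftrightarrow> (\<forall>t>0. \<forall>i. w t $ i > 0)"

lemma doubleton_Int:
  assumes "a \<noteq> b" "c \<noteq> d" "{a, b} \<noteq> {c, d}" "x \<in> {a, b} \<inter> {c, d}"
  shows "y \<in> {a, b} \<inter> {c, d} \<Longrightarrow> y = x"
    and "(x = a \<and> a \<in> {c, d} \<and> b \<notin> {c, d}) \<or> (x = b \<and> b \<in> {c, d} \<and> a \<notin> {c, d})"
  using assms by auto

lemma forman_matrix_offdiag:
  fixes u v :: "'n::finite \<Rightarrow> 'v"
  assumes "simple_graph V E" and "edge_enumeration E u v" and "i \<noteq> j"
  shows "forman_matrix m1 m2 u v $ i $ j =
    (if u i \<in> {u j, v j} then m2 {u j, v j} / m1 (u i) else 0) +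
    (if v i \<in> {u j, v j} then m2 {u j, v j} / m1 (v i) else 0)"
proof -
  have ne: "{u i, v i} \<noteq> {u j, v j}"
    using assms(2,3) by (auto simp: edge_enumeration_def bij_betw_def inj_on_def)
  have "{u k, v k} \<in> E" for k
    using assms(2) by (auto simp: edge_enumeration_def bij_betw_def)
  then have c: "card {u k, v k} = 2" for k
    using assms(1) unfolding simple_graph_def by blast
  have d: "u k \<noteq> v k" for k
  proof
    assume "u k = v k"
    with c[of k] show False by simp
  qed
  show ?thesis
  proof (cases "{u i, v i} \<inter> {u j, v j} = {}")
    case True
    then show ?thesis using \<open>i \<noteq> j\<close> by (auto simp: forman_matrix_def)
  next
    case False
    then obtain x where x: "x \<in> {u i, v i} \<inter> {u j, v j}" by blast
    have "y = x" if "y \<in> {u i, v i} \<inter> {u j, v j}" for y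
      by (rule doubleton_Int(1)[OF d d ne x that])
    with x have the: "(THE y. y \<in> {u i, v i} \<inter> {u j, v j}) = x"
      by (intro the_equality)
    have "forman_matrix m1 m2 u v $ i $ j = m2 {u j, v j} / m1 x"
      using False \<open>i \<noteq> j\<close> unfolding forman_matrix_def by (simp add: the del: Int_iff insert_iff)
    moreover have "(x = u i \<and> u i \<in> {u j, v j} \<and> v i \<notin> {u j, v j}) \<or>
        (x = v i \<and> v i \<in> {u j, v j} \<and> u i \<notin> {u j, v j})"
      by (rule doubleton_Int(2)[OF d d ne x])
    ultimately show ?thesis by auto
  qed
qed

text \<open>The linear system is the flow driven by the weighted Forman curvature.\<close>

lemma forman_matrix_curvature:
  fixes u v :: "'n::finite \<Rightarrow> 'v" and w :: "'v set \<Rightarrow> real"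
  assumes G: "simple_graph V E" and en: "edge_enumeration E u v" and "w {u i, v i} \<noteq> 0"
  shows "(forman_matrix m1 m2 u v *v (\<chi> j. w {u j, v j})) $ i =
    - forman_curvature E m1 m2 w (u i) (v i) * w {u i, v i}"
proof -
  define W where "W = w {u i, v i}"
  have bij: "bij_betw (\<lambda>i. {u i, v i}) UNIV E"
    using en by (simp add: edge_enumeration_def)
  have W: "W \<noteq> 0" using assms(3) by (simp add: W_def)
  have S: "(\<Sum>e' | e' \<in> E \<and> x \<in> e' \<and> e' \<noteq> {u i, v i}. m2 e' / m1 x * (w e' / W)) * W =
      (\<Sum>j\<in>UNIV-{i}. if x \<in> {u j, v j} then m2 {u j, v j} / m1 x * w {u j, v j} else 0)" for x
  proof -
    have "bij_betw (\<lambda>i. {u i, v i}) {j \<in> UNIV - {i}. x \<in> {u j, v j}}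
        {e' \<in> E. x \<in> e' \<and> e' \<noteq> {u i, v i}}"
      using bij unfolding bij_betw_def inj_on_def by auto
    from sum.reindex_bij_betw[OF this, of "\<lambda>e'. m2 e' / m1 x * w e'"]
    have "(\<Sum>e' | e' \<in> E \<and> x \<in> e' \<and> e' \<noteq> {u i, v i}. m2 e' / m1 x * w e') =
        (\<Sum>j | j \<in> UNIV - {i} \<and> x \<in> {u j, v j}. m2 {u j, v j} / m1 x * w {u j, v j})"
      by simp
    also have "\<dots> = (\<Sum>j\<in>UNIV-{i}. if x \<in> {u j, v j} then m2 {u j, v j} / m1 x * w {u j, v j} else 0)"
      by (rule sum.inter_filter) simp
    finally show ?thesis using W by (simp add: sum_distrib_right)
  qed
  have "(forman_matrix m1 m2 u v *v (\<chi> j. w {u j, v j})) $ i =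
      forman_matrix m1 m2 u v $ i $ i * W +
      (\<Sum>j\<in>UNIV-{i}. forman_matrix m1 m2 u v $ i $ j * w {u j, v j})"
    by (simp add: matrix_vector_mult_def W_def sum.remove[of UNIV i])
  also have "(\<Sum>j\<in>UNIV-{i}. forman_matrix m1 m2 u v $ i $ j * w {u j, v j}) =
      (\<Sum>j\<in>UNIV-{i}. (if u i \<in> {u j, v j} then m2 {u j, v j} / m1 (u i) * w {u j, v j} else 0) +
        (if v i \<in> {u j, v j} then m2 {u j, v j} / m1 (v i) * w {u j, v j} else 0))"
    by (rule sum.cong) (auto simp: forman_matrix_offdiag[OF G en] algebra_simps)
  also have "forman_matrix m1 m2 u v $ i $ i =
      - (m2 {u i, v i} / m1 (u i) + m2 {u i, v i} / m1 (v i))"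
    by (simp add: forman_matrix_def)
  finally show ?thesis
    unfolding forman_curvature_def W_def[symmetric] sum.distrib S[symmetric]
    by (simp add: algebra_simps)
qed

end

theory Submission
  imports Defs
begin

text \<open>
  The power series of the exponential shows that \<open>t \<mapsto> e\<^sup>t\<^sup>A x\<close> solves \<open>w' = A w\<close>, and a Gronwall
  estimate for the squared norm of a difference gives uniqueness. For positivity, choose \<open>c\<close> such
  that \<open>B = F + c I\<close> has no negative entry, which is possible because the off-diagonal entries of
  \<open>F\<close> are nonnegative. Both \<open>e\<^sup>t\<^sup>F w\<close> and \<open>e\<^sup>-\<^sup>c\<^sup>t e\<^sup>t\<^sup>B w\<close> solve the flow, so they agree, and every
  term of the series for \<open>e\<^sup>t\<^sup>B w\<close> is nonnegative, the first one being \<open>w\<close> itself.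
\<close>

lemma matrix_power_scaleR_vector:
  fixes A :: "real^'n^'n"
  shows "((\<lambda>B. (t *\<^sub>R A) ** B) ^^ k) (mat 1) *v x = t ^ k *\<^sub>R (((*v) A) ^^ k) x"
  by (induction k)
    (simp_all add: matrix_vector_mul_assoc[symmetric] scaleR_matrix_vector_assoc[symmetric]
      matrix_vector_mult_scaleR)

lemma bounded_bilinear_matrix_mult:
  "bounded_bilinear ((**) :: real^'n^'m \<Rightarrow> real^'p^'n \<Rightarrow> real^'p^'m)"
  unfolding bilinear_conv_bounded_bilinear[symmetric] bilinear_def linear_iff
  by (simp add: matrix_matrix_mult_def vec_eq_iff sum.distrib sum_distrib_left distrib_left
      distrib_right mult_ac)

text \<open>Bilinearity of the matrix product bounds the norm of a product by the product of the
  norms up to a constant \<open>K\<close>. The series is therefore dominated by the real exponential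
  series at \<open>norm A * K\<close>.\<close>

lemma summable_matrix_exp:
  fixes A :: "real^'n^'n"
  shows "summable (\<lambda>k. (1 / fact k) *\<^sub>R ((\<lambda>B. A ** B) ^^ k) (mat 1))"
proof -
  obtain K where K: "K > 0" "\<And>B (C :: real^'n^'n). norm ((B :: real^'n^'n) ** C) \<le> norm B * norm C * K"
    using bounded_bilinear.pos_bounded[OF bounded_bilinear_matrix_mult] by blast
  have bd: "norm (((\<lambda>B. A ** B) ^^ k) (mat 1)) \<le> (norm A * K) ^ k * norm (mat 1 :: real^'n^'n)" for k
  proof (induction k)
    case (Suc k)
    have "norm (((\<lambda>B. A ** B) ^^ Suc k) (mat 1)) \<le> norm A * K * norm (((\<lambda>B. A ** B) ^^ k) (mat 1))"
      using K(2)[of A "((\<lambda>B. A ** B) ^^ k) (mat 1)"] by (simp add: mult_ac)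
    also have "\<dots> \<le> norm A * K * ((norm A * K) ^ k * norm (mat 1 :: real^'n^'n))"
      using Suc K(1) by (intro mult_left_mono) auto
    finally show ?case by (simp add: mult_ac)
  qed simp
  have "summable (\<lambda>k. (inverse (fact k) * (norm A * K) ^ k) * norm (mat 1 :: real^'n^'n))"
    by (intro summable_mult2 summable_exp)
  then show ?thesis
    by (rule summable_comparison_test'[where N = 0])
      (use bd in \<open>simp add: divide_simps mult_ac\<close>)
qed

text \<open>Evaluation at \<open>x\<close> followed by a coordinate is a bounded linear functional
  of the matrix, so it passes through the series. What remains is a real power series in
  \<open>t\<close>, open to termwise calculus.\<close>

lemma matrix_exp_vector_sums:
  fixes A :: "real^'n^'n"
  shows "(\<lambda>k. ((((*v) A) ^^ k) x $ i / fact k) * t ^ k) sums ((matrix_exp (t *\<^sub>R A) *v x) $ i)"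
proof -
  have "linear (\<lambda>B::real^'n^'n. (B *v x) $ i)"
    by (simp add: linear_iff matrix_vector_mult_add_rdistrib scaleR_matrix_vector_assoc[symmetric])
  then have "bounded_linear (\<lambda>B::real^'n^'n. (B *v x) $ i)"
    by (simp add: linear_conv_bounded_linear)
  from bounded_linear.sums[OF this summable_sums[OF summable_matrix_exp[of "t *\<^sub>R A"]]]
  show ?thesis
    by (simp add: matrix_exp_def scaleR_matrix_vector_assoc[symmetric] matrix_power_scaleR_vector
        mult_ac)
qed

lemma matrix_exp_0: "matrix_exp (0 *\<^sub>R A) *v x = x"
proof (subst vec_eq_iff, rule allI)
  fix i
  \<comment> \<open>As \<open>0 ^ 0 = 1\<close>, the constant term survives.\<close>
  have "(\<lambda>k. ((((*v) A) ^^ k) x $ i / fact k) * 0 ^ k) sums (x $ i)"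
    using powser_sums_zero[of "\<lambda>k. (((*v) A) ^^ k) x $ i / fact k"] by simp
  then show "(matrix_exp (0 *\<^sub>R A) *v x) $ i = x $ i"
    using matrix_exp_vector_sums sums_unique2 by blast
qed

lemma has_vector_derivative_vec_nth:
  fixes f :: "real \<Rightarrow> real^'n"
  assumes "\<And>i. ((\<lambda>t. f t $ i) has_real_derivative f' $ i) (at t)"
  shows "(f has_vector_derivative f') (at t)"
  using assms unfolding has_vector_derivative_def has_derivative_componentwise_within[of f]
  by (auto simp: Basis_vec_def inner_axis has_field_derivative_def mult_commute_abs)

text \<open>Each coordinate is a power series converging for every real \<open>t\<close>, hence
  differentiable term by term.\<close>

lemma matrix_exp_has_vector_derivative:
  fixes A :: "real^'n^'n"
  shows "((\<lambda>t. matrix_exp (t *\<^sub>R A) *v x) has_vector_derivative A *v (matrix_exp (t *\<^sub>R A) *v x)) (at t)"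
proof (rule has_vector_derivative_vec_nth)
  fix i
  define c where "c k = (((*v) A) ^^ k) x $ i / fact k" for k
  have s: "(\<lambda>k. c k * t ^ k) sums ((matrix_exp (t *\<^sub>R A) *v x) $ i)" for t
    unfolding c_def by (rule matrix_exp_vector_sums)
  \<comment> \<open>The factor \<open>Suc k\<close> from \<open>diffs\<close> cancels against
    \<open>fact (Suc k)\<close>; the one extra application of \<open>A\<close> is expanded along row
    \<open>i\<close>.\<close>
  have "diffs c k = (\<Sum>j\<in>UNIV. A $ i $ j * ((((*v) A) ^^ k) x $ j / fact k))" for k
    by (simp add: diffs_def c_def matrix_vector_mult_def[of A] sum_divide_distrib[symmetric]
        del: of_nat_Suc)
  then have "(\<lambda>k. diffs c k * t ^ k) sums
      (\<Sum>j\<in>UNIV. A $ i $ j * (matrix_exp (t *\<^sub>R A) *v x) $ j)"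
    by (simp add: sum_distrib_right mult.assoc sums_sum sums_mult matrix_exp_vector_sums
        del: times_divide_eq_left times_divide_eq_right)
  then have "(\<Sum>k. diffs c k * t ^ k) = (A *v (matrix_exp (t *\<^sub>R A) *v x)) $ i"
    by (simp add: matrix_vector_mult_def[of A] sums_unique[symmetric])
  moreover have "((\<lambda>t. \<Sum>k. c k * t ^ k) has_real_derivative (\<Sum>k. diffs c k * t ^ k)) (at t)"
    by (rule termdiffs_strong_converges_everywhere) (use s in \<open>auto simp: summable_def\<close>)
  moreover have "(\<lambda>t. \<Sum>k. c k * t ^ k) = (\<lambda>t. (matrix_exp (t *\<^sub>R A) *v x) $ i)"
    using s by (simp add: fun_eq_iff sums_unique[symmetric])
  ultimately show "((\<lambda>t. (matrix_exp (t *\<^sub>R A) *v x) $ i) has_real_derivative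
      (A *v (matrix_exp (t *\<^sub>R A) *v x)) $ i) (at t)"
    by simp
qed

text \<open>A derivative at every real time, 0 included, supplies the continuity on
  \<open>{0..}\<close>.\<close>

lemma linear_flow_solutionI:
  assumes "\<And>t. (w has_vector_derivative A *v w t) (at t)" and "w 0 = w0"
  shows "linear_flow_solution A w0 w"
  unfolding linear_flow_solution_def
  using assms
  by (auto intro!: continuous_at_imp_continuous_on has_vector_derivative_continuous)

lemma matrix_exp_linear_flow_solution:
  "linear_flow_solution A w0 (\<lambda>t. matrix_exp (t *\<^sub>R A) *v w0)"
  by (rule linear_flow_solutionI[OF matrix_exp_has_vector_derivative matrix_exp_0])

lemma linear_flow_solution_unique:
  fixes A :: "real^'n^'n"
  assumes w: "linear_flow_solution A w0 w" and z: "linear_flow_solution A w0 z" and t: "t \<ge> 0"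
  shows "w t = z t"
proof -
  define d where "d s = w s - z s" for s
  obtain L where L: "L > 0" "\<And>y. norm (A *v y) \<le> L * norm y"
    using bounded_linear.pos_bounded[OF matrix_vector_mul_bounded_linear[of A]]
    by (auto simp: mult.commute)
  \<comment> \<open>The derivative of \<open>d s \<bullet> d s\<close> is at most
    \<open>2 * L\<close> times itself; the weight \<open>exp (- 2 * L * s)\<close> absorbs this
    growth and makes \<open>g\<close> nonincreasing.\<close>
  define g where "g s = exp (- 2 * L * s) * (d s \<bullet> d s)" for s
  have d': "(d has_vector_derivative A *v d s) (at s)" if "s > 0" for s
    using w z that unfolding linear_flow_solution_def d_def matrix_vector_mult_diff_distrib
    by (auto intro!: has_vector_derivative_diff)
  have g': "\<exists>y. DERIV g s :> y \<and> y \<le> 0" if "s > 0" for s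
  proof (intro exI conjI)
    have "((\<lambda>s. d s \<bullet> d s) has_real_derivative (2 * (d s \<bullet> (A *v d s)))) (at s)"
      using bounded_bilinear.has_vector_derivative[OF bounded_bilinear_inner d' d', OF that that]
      by (simp add: has_real_derivative_iff_has_vector_derivative inner_commute)
    then show "DERIV g s :> exp (- 2 * L * s) * (2 * (d s \<bullet> (A *v d s)) - 2 * L * (d s \<bullet> d s))"
      unfolding g_def by (auto intro!: derivative_eq_intros simp: algebra_simps)
    have "d s \<bullet> (A *v d s) \<le> norm (d s) * norm (A *v d s)"
      by (rule norm_cauchy_schwarz)
    also have "\<dots> \<le> norm (d s) * (L * norm (d s))"
      by (intro mult_left_mono L) simp
    finally have "d s \<bullet> (A *v d s) \<le> L * (d s \<bullet> d s)"
      by (simp add: dot_square_norm power2_eq_square mult_ac)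
    then show "exp (- 2 * L * s) * (2 * (d s \<bullet> (A *v d s)) - 2 * L * (d s \<bullet> d s)) \<le> 0"
      by (simp add: mult_nonneg_nonpos)
  qed
  have "continuous_on {0..t} d"
    using w z unfolding linear_flow_solution_def d_def
    by (auto intro!: continuous_on_diff elim!: continuous_on_subset)
  then have "continuous_on {0..t} g"
    unfolding g_def by (intro continuous_intros)
  \<comment> \<open>The equation holds only for positive times, so monotonicity comes from the
    derivative on the open interval and continuity up to 0.\<close>
  then have "g t \<le> g 0"
    by (intro DERIV_nonpos_imp_decreasing_open[OF t] g')
  also have "g 0 = 0"
    using w z by (simp add: g_def d_def linear_flow_solution_def)
  finally have "d t \<bullet> d t \<le> 0"
    by (simp add: g_def mult_le_0_iff)
  then have "d t = 0"
    using inner_ge_zero[of "d t"] by (simp add: antisym)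
  then show ?thesis by (simp add: d_def)
qed

text \<open>The partial sum consisting of the term \<open>k = 0\<close> is a lower bound for a
  series of nonnegative terms. The bound \<open>x $ i\<close>, rather than 0, later yields strict
  positivity.\<close>

lemma matrix_exp_vector_ge:
  fixes B :: "real^'n^'n"
  assumes B: "\<And>i j. B $ i $ j \<ge> 0" and x: "\<And>i. x $ i \<ge> 0" and t: "t \<ge> 0"
  shows "(matrix_exp (t *\<^sub>R B) *v x) $ i \<ge> x $ i"
proof -
  have "(((*v) B) ^^ k) x $ i \<ge> 0" for k i
    by (induction k arbitrary: i) (auto simp: matrix_vector_mult_def[of B] B x intro!: sum_nonneg)
  then have "(\<Sum>k\<in>{0}. ((((*v) B) ^^ k) x $ i / fact k) * t ^ k) \<le>
      (\<Sum>k. ((((*v) B) ^^ k) x $ i / fact k) * t ^ k)"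
    using t sums_summable[OF matrix_exp_vector_sums] by (intro sum_le_suminf) auto
  then show ?thesis
    using sums_unique[OF matrix_exp_vector_sums[of B x i t]] by simp
qed

lemma matrix_exp_vector_pos:
  fixes A :: "real^'n^'n"
  assumes A: "\<And>i j. i \<noteq> j \<Longrightarrow> A $ i $ j \<ge> 0" and x: "\<And>i. x $ i > 0" and t: "t \<ge> 0"
  shows "(matrix_exp (t *\<^sub>R A) *v x) $ i > 0"
proof -
  \<comment> \<open>This sum dominates every diagonal entry in absolute value, so adding it on the
    diagonal leaves no negative entry there and keeps the others unchanged.\<close>
  define c where "c = (\<Sum>i\<in>UNIV. \<bar>A $ i $ i\<bar>)"
  define B where "B = A + c *\<^sub>R mat 1"
  have "\<bar>A $ i $ i\<bar> \<le> c" for i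
    unfolding c_def by (rule member_le_sum) auto
  then have "A $ i $ i + c \<ge> 0" for i
    by (smt (verit))
  then have B: "B $ i $ j \<ge> 0" for i j
    using A by (cases "i = j") (auto simp: B_def mat_def)
  have Bv: "B *v y = A *v y + c *\<^sub>R y" for y
    by (simp add: B_def matrix_vector_mult_add_rdistrib scaleR_matrix_vector_assoc[symmetric])
  define z where "z t = exp (- c * t) *\<^sub>R (matrix_exp (t *\<^sub>R B) *v x)" for t
  have "linear_flow_solution A x z"
  proof (rule linear_flow_solutionI)
    fix t
    have "((\<lambda>t. exp (- c * t)) has_real_derivative - c * exp (- c * t)) (at t)"
      by (auto intro!: derivative_eq_intros)
    \<comment> \<open>In the product rule, the term with \<open>- c\<close> from the scalar factor
      cancels the shift \<open>c *\<^sub>R y\<close> in \<open>Bv\<close>.\<close>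
    from has_vector_derivative_scaleR[OF this matrix_exp_has_vector_derivative[of B x t]]
    show "(z has_vector_derivative A *v z t) (at t)"
      unfolding z_def Bv by (simp add: matrix_vector_mult_scaleR algebra_simps)
  next
    show "z 0 = x" using matrix_exp_0[of B x] by (simp add: z_def)
  qed
  then have "matrix_exp (t *\<^sub>R A) *v x = z t"
    by (rule linear_flow_solution_unique[OF matrix_exp_linear_flow_solution _ t])
  moreover have "(matrix_exp (t *\<^sub>R B) *v x) $ i > 0"
    using matrix_exp_vector_ge[OF B _ t, of x i] x by (smt (verit))
  ultimately show ?thesis by (simp add: z_def)
qed

text \<open>The form of the entry given by \<open>forman_matrix_offdiag\<close> names the endpoints
  of edge \<open>i\<close> in place of a definite description. These lie in \<open>V\<close>, where
  \<open>m1\<close> is positive, so both summands are nonnegative.\<close>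

lemma forman_matrix_offdiag_nonneg:
  fixes u v :: "'n::finite \<Rightarrow> 'v"
  assumes G: "simple_graph V E" and en: "edge_enumeration E u v"
    and m1: "\<And>x. x \<in> V \<Longrightarrow> m1 x > 0" and m2: "\<And>e. e \<in> E \<Longrightarrow> m2 e > 0" and "i \<noteq> j"
  shows "forman_matrix m1 m2 u v $ i $ j \<ge> 0"
proof -
  have E: "{u k, v k} \<in> E" for k
    using en by (auto simp: edge_enumeration_def bij_betw_def)
  then have "{u k, v k} \<subseteq> V" for k
    using G unfolding simple_graph_def by metis
  then have "m1 (u k) > 0" "m1 (v k) > 0" for k
    using m1 by auto
  with m2[OF E] show ?thesis
    unfolding forman_matrix_offdiag[OF G en \<open>i \<noteq> j\<close>]
    by (intro add_nonneg_nonneg) (auto simp: less_imp_le)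
qed

theorem theorem3p2:
  fixes V :: "'v set" and E :: "'v set set"
    and m1 :: "'v \<Rightarrow> real" and m2 :: "'v set \<Rightarrow> real"
    and u v :: "'n::finite \<Rightarrow> 'v"
    and \<omega>0 :: "real^'n"
  assumes "simple_graph V E"
    and "graph_connected V E"
    and "edge_enumeration E u v"
    and "\<And>x. x \<in> V \<Longrightarrow> m1 x > 0"
    and "\<And>e. e \<in> E \<Longrightarrow> m2 e > 0"
    and "\<And>i. \<omega>0 $ i > 0"
  defines "F \<equiv> forman_matrix m1 m2 u v"
  defines "\<Omega> \<equiv> \<lambda>t. matrix_exp (t *\<^sub>R F) *v \<omega>0"
  shows "linear_flow_solution F \<omega>0 \<Omega> \<and> positive_flow \<Omega> \<and>
    (\<forall>\<omega>. linear_flow_solution F \<omega>0 \<omega> \<and> positive_flow \<omega> \<longrightarrow> (\<forall>t\<ge>0. \<omega> t = \<Omega> t))"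
proof -
  have "positive_flow \<Omega>"
    unfolding positive_flow_def \<Omega>_def F_def
    using matrix_exp_vector_pos[OF forman_matrix_offdiag_nonneg[OF assms(1,3,4,5)] assms(6)]
    by (simp add: less_imp_le)
  moreover have "linear_flow_solution F \<omega>0 \<Omega>"
    unfolding \<Omega>_def by (rule matrix_exp_linear_flow_solution)
  ultimately show ?thesis
    using linear_flow_solution_unique by blast
qed

end
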